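(* Let $\lambda$ be a nonzero real number. For every integer $k\ge 1$, as formal power series in $x$, $$\sum_{n=1}^{\infty}H_{n,\lambda}(n)_{k,\lambda}x^{n}=\frac{1}{1-x}HF_{k,\lambda}\Big(\frac{x}{1-x}\Big)-\frac{\log_{\lambda}(1-x)}{1-x}F_{k,\lambda}^{(1-\lambda)}\Big(\frac{x}{1-x}\Big).$$
   Context: Fix a nonzero real $\lambda$. All generating functions are formal power series, with $(1+u)^{a}=\sum_{j\ge0}\binom{a}{j}u^{j}$. Notation: $(x)_{0,\lambda}=1$ and $(x)_{n,\lambda}=x(x-\lambda)\cdots(x-(n-1)\lambda)$ for $n\ge1$. Degenerate logarithm: $\log_{\lambda}(1+t)=\frac{1}{\lambda}\big((1+t)^{\lambda}-1\big)$. Degenerate exponential: $e_{\lambda}(t)=(1+\lambda t)^{1/\lambda}=\sum_{n\ge0}(1)_{n,\lambda}\frac{t^{n}}{n!}$. Degenerate harmonic numbers $H_{n,\lambda}$: defined by $-\frac{\log_{\lambda}(1-t)}{1-t}=\sum_{n=1}^{\infty}H_{n,\lambda}t^{n}$. Degenerate harmonic-Fubini polynomials $HF_{n,\lambda}(x)$: defined by $$-\frac{\log_{\lambda}\big(1-x(e_{\lambda}(t)-1)\big)}{1-x(e_{\lambda}(t)-1)}=\sum_{n=1}^{\infty}HF_{n,\lambda}(x)\frac{t^{n}}{n!}.$$ For $\alpha\in\mathbb{R}$, the degenerate Fubini polynomials of order $\alpha$, $F_{n,\lambda}^{(\alpha)}(x)$, are defined by $$\bigg(\frac{1}{1-x(e_{\lambda}(t)-1)}\bigg)^{\alpha}=\sum_{n=0}^{\infty}F_{n,\lambda}^{(\alpha)}(x)\frac{t^{n}}{n!}.$$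 *)

theory Defs
  imports "HOL-Computational_Algebra.Computational_Algebra"
begin

text \<open>Throughout, \<open>l\<close> is the degeneracy parameter \<open>\<lambda>\<close>.\<close>

definition deg_falling :: "real \<Rightarrow> real \<Rightarrow> nat \<Rightarrow> real" where
  "deg_falling l x n = (\<Prod>i<n. x - real i * l)"

text \<open>The series \<open>log\<^sub>\<lambda>(1 + t)\<close> and \<open>e\<^sub>\<lambda>(t) = (1 + \<lambda>t)\<^bsup>1/\<lambda>\<^esup>\<close> in the indeterminate \<open>t\<close>;
  \<^term>\<open>fps_binomial a\<close> is the series \<open>(1 + u)\<^sup>a\<close>.\<close>

definition deg_log :: "real \<Rightarrow> real fps" where
  "deg_log l = fps_const (1 / l) * (fps_binomial l - 1)"

definition deg_exp :: "real \<Rightarrow> real fps" where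
  "deg_exp l = fps_binomial (1 / l) oo (fps_const l * fps_X)"

definition deg_log_minus :: "real \<Rightarrow> real fps" where
  "deg_log_minus l = deg_log l oo (- fps_X)"  \<comment> \<open>\<open>log\<^sub>\<lambda>(1 - t)\<close>\<close>

definition deg_harmonic :: "real \<Rightarrow> nat \<Rightarrow> real" where
  "deg_harmonic l n = fps_nth (- (deg_log_minus l / (1 - fps_X))) n"

text \<open>The two polynomial families live in \<open>\<real>[x][[t]]\<close>, of type \<^typ>\<open>real poly fps\<close>; real
  series in \<open>t\<close> are embedded by making their coefficients constant polynomials.\<close>

definition fps_lift :: "real fps \<Rightarrow> real poly fps" where
  "fps_lift f = Abs_fps (\<lambda>n. [:fps_nth f n:])"

text \<open>\<open>u = x(e\<^sub>\<lambda>(t) - 1)\<close>. Its constant term in \<open>t\<close> is zero, so series in one variable may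
  be composed with it.\<close>

definition fubini_arg :: "real \<Rightarrow> real poly fps" where
  "fubini_arg l = fps_const [:0, 1:] * (fps_lift (deg_exp l) - 1)"

text \<open>\<open>1/(1 - u)\<close>. Since \<^typ>\<open>real poly\<close> is not a field, the operation
  \<^term>\<open>inverse\<close> is not available on \<^typ>\<open>real poly fps\<close>; the constant term \<open>1\<close> of
  \<open>1 - u\<close> is supplied with its inverse \<open>1\<close> explicitly.\<close>

definition fubini_geom :: "real \<Rightarrow> real poly fps" where
  "fubini_geom l = fps_right_inverse (1 - fubini_arg l) 1"

definition harmonic_fubini :: "real \<Rightarrow> nat \<Rightarrow> real poly" where
  "harmonic_fubini l n =
     smult (fact n) (fps_nth (- ((fps_lift (deg_log l) oo (- fubini_arg l)) * fubini_geom l)) n)"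

text \<open>The power \<open>(1/(1 - u))\<^sup>a\<close> is \<open>(1 + w)\<^sup>a\<close> with \<open>w = 1/(1 - u) - 1\<close>.\<close>

definition deg_fubini :: "real \<Rightarrow> real \<Rightarrow> nat \<Rightarrow> real poly" where
  "deg_fubini l a n =
     smult (fact n) (fps_nth (fps_lift (fps_binomial a) oo (fubini_geom l - 1)) n)"

text \<open>The value of a real polynomial at a formal power series.\<close>

definition poly_at_fps :: "real poly \<Rightarrow> real fps \<Rightarrow> real fps" where
  "poly_at_fps p f = poly (map_poly fps_const p) f"

lemma deg_exp_nth:
  assumes "l \<noteq> 0"
  shows "fps_nth (deg_exp l) n = deg_falling l 1 n / fact n"
proof -
  have "fps_nth (deg_exp l) n = l ^ n * ((1 / l) gchoose n)"
    unfolding deg_exp_def by (simp add: fps_compose_linear)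
  also have "\<dots> = (\<Prod>i<n. l * (1 / l - real i)) / fact n"
    by (simp add: gbinomial_prod_rev prod.distrib atLeast0LessThan)
  also have "(\<Prod>i<n. l * (1 / l - real i)) = deg_falling l 1 n"
    unfolding deg_falling_def using assms by (intro prod.cong) (auto simp: field_simps)
  finally show ?thesis .
qed

lemma fubini_arg_nth_0: "fps_nth (fubini_arg l) 0 = 0"
  by (simp add: fubini_arg_def fps_lift_def deg_exp_def one_pCons)

lemma fubini_geom: "(1 - fubini_arg l) * fubini_geom l = 1"
  unfolding fubini_geom_def by (rule fps_right_inverse) (simp add: fubini_arg_nth_0)

text \<open>The constant terms vanish, in accordance with generating functions that start at
  \<open>n = 1\<close>.\<close>

lemma deg_harmonic_0: "deg_harmonic l 0 = 0"
  by (simp add: deg_harmonic_def deg_log_minus_def deg_log_def fps_divide_unit)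

lemma harmonic_fubini_0: "harmonic_fubini l 0 = 0"
  by (simp add: harmonic_fubini_def fps_lift_def deg_log_def)

end

theory Submission
  imports Defs
begin

text \<open>
  Write \<open>e\<close> for \<open>e\<^sub>\<lambda>(t)\<close> and \<open>y = x/(1 - x)\<close>. Since \<open>e\<^sup>n = \<Sum>\<^sub>k (n)\<^bsub>k,\<lambda>\<^esub> t\<^sup>k/k!\<close>, the operation
  \<open>\<Sum> g\<^sub>n x\<^sup>n \<mapsto> \<Sum> g\<^sub>n (n)\<^bsub>k,\<lambda>\<^esub> x\<^sup>n\<close> extracts \<open>k! [t\<^sup>k]\<close> from \<open>g(x e)\<close>. The identity rests on the
  factorisation \<open>1 - x e = (1 - x)(1 - y(e - 1))\<close>. Raised to the power \<open>a\<close>, it says that the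
  operation takes \<open>(1 - x)\<^sup>a\<close> to \<open>(1 - x)\<^sup>a P(y)\<close>, where the polynomial
  \<open>P(x) = k! [t\<^sup>k] (1 - x(e - 1))\<^sup>a\<close> depends on \<open>a\<close> (\<open>deg_falling_weighted_one_minus_powr\<close>).

  Everything in the theorem is a linear combination of such powers, because
  \<open>-log\<^sub>\<lambda>(1 - u)/(1 - u) = ((1 - u)\<^sup>-\<^sup>1 - (1 - u)\<^bsup>\<lambda>-1\<^esup>)/\<lambda>\<close>. Hence the exponents \<open>\<lambda> - 1\<close> and \<open>-1\<close> suffice:
  the polynomial for \<open>\<lambda> - 1\<close> minus that for \<open>-1\<close> is \<open>-\<lambda>\<close> times the harmonic-Fubini polynomial,
  and the polynomial for \<open>\<lambda> - 1\<close> is the Fubini polynomial of order \<open>1 - \<lambda>\<close>.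

  A series in \<open>u\<close> cannot be composed with \<open>x e\<close>, whose constant term in \<open>t\<close> is \<open>x\<close>. The factorisation
  is therefore used through coefficients: \<open>e\<^sup>n\<close> is expanded in powers of \<open>e - 1\<close>
  (\<open>deg_falling_eq_sum_choose\<close>), and the effect of the weights \<open>n choose j\<close> on \<open>(1 - x)\<^sup>a\<close> is computed
  (\<open>choose_weighted_one_minus_powr\<close>).
\<close>

section \<open>Real powers of \<open>1 - x\<close>\<close>

definition one_minus_powr :: "real \<Rightarrow> real fps" where
  "one_minus_powr a = fps_binomial a oo (- fps_X)"

lemma one_minus_powr_nth: "fps_nth (one_minus_powr a) n = (-1) ^ n * (a gchoose n)"
  by (simp add: one_minus_powr_def fps_compose_uminus')

lemma one_minus_powr_add: "one_minus_powr (a + b) = one_minus_powr a * one_minus_powr b"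
  by (simp add: one_minus_powr_def fps_binomial_add_mult fps_compose_mult_distrib)

lemma one_minus_powr_0: "one_minus_powr 0 = 1"
  by (simp add: one_minus_powr_def)

lemma one_minus_powr_1: "one_minus_powr 1 = 1 - fps_X"
  by (simp add: one_minus_powr_def fps_binomial_1 fps_compose_add_distrib)

lemma divide_one_minus_fps_X: "f / (1 - fps_X) = f * one_minus_powr (- 1)"
proof -
  have "(1 - fps_X) * one_minus_powr (- 1) = 1"
    using one_minus_powr_add[of 1 "- 1"] by (simp add: one_minus_powr_0 one_minus_powr_1)
  then have "inverse (1 - fps_X :: real fps) = one_minus_powr (- 1)"
    by (rule fps_inverse_unique)
  then show ?thesis
    by (simp add: fps_divide_unit)
qed

lemma one_minus_powr_diff_of_nat:
  "one_minus_powr (a - real j) = one_minus_powr a * one_minus_powr (- 1) ^ j"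
proof (induction j)
  case (Suc j)
  have "one_minus_powr (a - real (Suc j)) = one_minus_powr (a - real j) * one_minus_powr (- 1)"
    by (simp flip: one_minus_powr_add add: algebra_simps)
  then show ?case
    by (simp add: Suc.IH mult_ac)
qed simp

text \<open>The factor \<open>n choose j\<close> acts as the operator \<open>x\<^sup>j/j! d\<^sup>j/dx\<^sup>j\<close>, which multiplies \<open>(1 - x)\<^sup>a\<close> by a
  constant times \<open>(x/(1 - x))\<^sup>j\<close>. On coefficients this is the trinomial revision of binomials.\<close>

lemma choose_weighted_one_minus_powr:
  "Abs_fps (\<lambda>n. fps_nth (one_minus_powr a) n * real (n choose j)) =
     fps_const (fps_nth (one_minus_powr a) j) * one_minus_powr a * (fps_X / (1 - fps_X)) ^ j"
proof -
  have "fps_const (fps_nth (one_minus_powr a) j) * one_minus_powr a * (fps_X / (1 - fps_X)) ^ j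
      = fps_const (fps_nth (one_minus_powr a) j) * (fps_X ^ j * one_minus_powr (a - real j))"
    by (simp add: divide_one_minus_fps_X one_minus_powr_diff_of_nat power_mult_distrib mult_ac)
  also have "\<dots> = Abs_fps (\<lambda>n. fps_nth (one_minus_powr a) n * real (n choose j))"
  proof (rule fps_ext)
    fix n
    show "fps_nth (fps_const (fps_nth (one_minus_powr a) j) * (fps_X ^ j * one_minus_powr (a - real j))) n
        = fps_nth (Abs_fps (\<lambda>n. fps_nth (one_minus_powr a) n * real (n choose j))) n"
    proof (cases "j \<le> n")
      case True
      have "(a gchoose n) * real (n choose j) = (a gchoose j) * (a - real j gchoose (n - j))"
        using gbinomial_trinomial_revision[OF True, of a] by (simp add: binomial_gbinomial)
      moreover have "(-1 :: real) ^ n = (-1) ^ j * (-1) ^ (n - j)"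
        using True by (simp flip: power_add)
      ultimately show ?thesis
        using True by (simp add: fps_X_power_mult_nth one_minus_powr_nth)
    next
      case False
      then show ?thesis
        by (simp add: fps_X_power_mult_nth)
    qed
  qed
  finally show ?thesis ..
qed

text \<open>The binomial series of \<open>(1 + w)\<^sup>a\<close> at \<open>w = 1/(1 - x) - 1\<close> solves the differential equation that
  characterises \<open>(1 - x)\<^sup>-\<^sup>a\<close>.\<close>

lemma fps_binomial_compose_geometric:
  "fps_binomial a oo (1 / (1 - fps_X) - 1) = one_minus_powr (- a)"
proof -
  define q where "q = one_minus_powr (- 1)"
  have q: "1 / (1 - fps_X) = q"
    by (simp add: q_def divide_one_minus_fps_X)
  have q0: "fps_nth (q - 1) 0 = 0"
    by (simp add: q_def one_minus_powr_nth)
  have Xq: "(1 - fps_X) * q = 1"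
    using one_minus_powr_add[of 1 "- 1"] by (simp add: q_def one_minus_powr_0 one_minus_powr_1)
  have dq: "fps_deriv q = q * q"
  proof -
    have "fps_deriv ((1 - fps_X) * q) = 0"
      by (simp add: Xq)
    then have "(1 - fps_X) * fps_deriv q = q"
      by (simp add: algebra_simps)
    then have "(1 - fps_X) * q * fps_deriv q = q * q"
      by (metis mult.assoc mult.commute)
    then show ?thesis
      using Xq by simp
  qed
  define g where "g = fps_binomial a oo (q - 1)"
  have dg: "(1 - fps_X) * fps_deriv g = fps_const a * g"
  proof -
    have "(1 + fps_X) * fps_deriv (fps_binomial a) = fps_const a * fps_binomial a"
      by (simp add: fps_binomial_deriv fps_divide_unit inverse_mult_eq_1' mult.left_commute
                    [of "1 + fps_X"])
    then have "((1 + fps_X) * fps_deriv (fps_binomial a)) oo (q - 1)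
        = (fps_const a * fps_binomial a) oo (q - 1)"
      by simp
    then have "q * (fps_deriv (fps_binomial a) oo (q - 1)) = fps_const a * g"
      using q0 by (simp add: fps_compose_mult_distrib fps_compose_add_distrib g_def)
    moreover have "fps_deriv g = (fps_deriv (fps_binomial a) oo (q - 1)) * (q * q)"
      unfolding g_def by (subst fps_compose_deriv[OF q0]) (simp add: dq)
    ultimately have "fps_deriv g = fps_const a * g * q"
      by (simp add: mult_ac)
    then show ?thesis
      using Xq by (metis mult.assoc mult.commute mult.right_neutral)
  qed
  have "g = one_minus_powr (- a)"
  proof (rule fps_ext)
    fix n
    show "fps_nth g n = fps_nth (one_minus_powr (- a)) n"
    proof (induction n)
      case 0
      show ?case by (simp add: g_def one_minus_powr_nth)
    next
      case (Suc n)
      have "fps_nth ((1 - fps_X) * fps_deriv g) n = a * fps_nth g n"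
        by (simp add: dg)
      then have "real (Suc n) * fps_nth g (Suc n) = (a + real n) * fps_nth g n"
        by (cases n) (simp_all add: left_diff_distrib algebra_simps)
      also have "\<dots> = real (Suc n) * fps_nth (one_minus_powr (- a)) (Suc n)"
      proof -
        have "real (Suc n) * (- a gchoose Suc n) = (- a - real n) * (- a gchoose n)"
          using gbinomial_absorb_comp[of "- a" n] gbinomial_absorption[of n "- a"] by simp
        then have "(-1) ^ Suc n * (real (Suc n) * (- a gchoose Suc n))
            = (-1) ^ n * ((a + real n) * (- a gchoose n))"
          by (simp only:) (simp add: algebra_simps)
        then show ?thesis
          by (simp only: Suc.IH one_minus_powr_nth mult_ac)
      qed
      finally show ?case
        by (simp del: of_nat_Suc)
    qed
  qed
  then show ?thesis
    by (simp add: g_def q)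
qed

section \<open>Powers of the degenerate exponential\<close>

lemma deg_exp_power_nth:
  assumes "l \<noteq> 0"
  shows "fps_nth (deg_exp l ^ n) k = deg_falling l (real n) k / fact k"
proof -
  have "deg_exp l ^ n = fps_binomial (real n / l) oo (fps_const l * fps_X)"
    unfolding deg_exp_def by (subst fps_compose_power) (simp_all add: fps_binomial_power)
  then have "fps_nth (deg_exp l ^ n) k = l ^ k * ((real n / l) gchoose k)"
    by simp
  also have "\<dots> = (\<Prod>i<k. l * (real n / l - real i)) / fact k"
    by (simp add: gbinomial_prod_rev prod.distrib atLeast0LessThan)
  also have "(\<Prod>i<k. l * (real n / l - real i)) = deg_falling l (real n) k"
    unfolding deg_falling_def using assms by (intro prod.cong) (auto simp: field_simps)
  finally show ?thesis .
qed

text \<open>These are \<open>j!\<close> times the degenerate Stirling numbers of the second kind.\<close>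

definition deg_surj :: "real \<Rightarrow> nat \<Rightarrow> nat \<Rightarrow> real" where
  "deg_surj l k j = fact k * fps_nth ((deg_exp l - 1) ^ j) k"

lemma deg_surj_eq_0:
  assumes "k < j"
  shows "deg_surj l k j = 0"
proof -
  have "fps_nth (deg_exp l - 1) 0 = 0"
    by (simp add: deg_exp_def)
  then show ?thesis
    using assms startsby_zero_power_prefix[of "deg_exp l - 1" j] by (simp add: deg_surj_def)
qed

lemma deg_falling_eq_sum_choose:
  assumes "l \<noteq> 0"
  shows "deg_falling l (real n) k = (\<Sum>j\<le>k. real (n choose j) * deg_surj l k j)"
proof -
  have "deg_falling l (real n) k = fact k * fps_nth ((deg_exp l - 1 + 1) ^ n) k"
    using assms by (simp add: deg_exp_power_nth)
  also have "\<dots> = (\<Sum>j\<le>n. real (n choose j) * deg_surj l k j)"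
    by (subst binomial_ring)
       (simp add: fps_sum_nth deg_surj_def sum_distrib_left mult_ac flip: fps_of_nat)
  \<comment> \<open>The binomials vanish for \<open>j > n\<close> and the coefficients of \<open>(e\<^sub>\<lambda>(t) - 1)\<^sup>j\<close> for \<open>j > k\<close>, so either
    bound may be used.\<close>
  also have "\<dots> = (\<Sum>j\<le>max n k. real (n choose j) * deg_surj l k j)"
    by (rule sum.mono_neutral_left) auto
  also have "\<dots> = (\<Sum>j\<le>k. real (n choose j) * deg_surj l k j)"
    by (rule sum.mono_neutral_right) (auto simp: deg_surj_eq_0)
  finally show ?thesis .
qed

section \<open>Series in \<open>x(e\<^sub>\<lambda>(t) - 1)\<close>\<close>

lemma const_poly_sum: "[:\<Sum>i\<in>A. f i:] = (\<Sum>i\<in>A. [:f i:])"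
proof (induction A rule: infinite_finite_induct)
  case (insert x F)
  have "[:f x + sum f F:] = [:f x:] + [:sum f F:]"
    by simp
  then show ?case
    using insert by simp
qed simp_all

lemma fps_lift_nth: "fps_nth (fps_lift f) n = [:fps_nth f n:]"
  by (simp add: fps_lift_def)

lemma fps_lift_1: "fps_lift 1 = 1"
  by (rule fps_ext) (simp add: fps_lift_nth one_pCons)

lemma fps_lift_diff: "fps_lift (f - g) = fps_lift f - fps_lift g"
  by (rule fps_ext) (simp add: fps_lift_nth)

lemma fps_lift_mult: "fps_lift (f * g) = fps_lift f * fps_lift g"
  by (rule fps_ext) (simp add: fps_lift_nth fps_mult_nth const_poly_sum mult.commute)

lemma fps_lift_power: "fps_lift (f ^ n) = fps_lift f ^ n"
  by (induction n) (simp_all add: fps_lift_1 fps_lift_mult)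

lemma fps_lift_X: "fps_lift fps_X = fps_X"
  by (rule fps_ext) (simp add: fps_lift_nth fps_X_nth one_pCons)

lemma fps_lift_compose: "fps_lift (f oo g) = fps_lift f oo fps_lift g"
  by (rule fps_ext)
     (simp add: fps_lift_nth fps_compose_nth const_poly_sum mult.commute flip: fps_lift_power)

text \<open>\<open>fubini_poly l g k = k! [t\<^sup>k] g(x(e\<^sub>\<lambda>(t) - 1))\<close> puts both families of polynomials, and
  \<open>k! [t\<^sup>k] (1 - x(e\<^sub>\<lambda>(t) - 1))\<^sup>a\<close>, into one form that is linear in \<open>g\<close>.\<close>

definition fubini_poly :: "real \<Rightarrow> real fps \<Rightarrow> nat \<Rightarrow> real poly" where
  "fubini_poly l g k = smult (fact k) (fps_nth (fps_lift g oo fubini_arg l) k)"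

lemma fubini_geom_eq: "fubini_geom l = fps_lift (1 / (1 - fps_X)) oo fubini_arg l"
proof -
  have "(1 - fps_X) * (1 / (1 - fps_X)) = (1 :: real fps)"
    by (simp add: fps_divide_unit inverse_mult_eq_1')
  then have "(1 - fps_X) * fps_lift (1 / (1 - fps_X)) = 1"
    by (metis fps_lift_mult fps_lift_diff fps_lift_1 fps_lift_X)
  then have "((1 - fps_X) * fps_lift (1 / (1 - fps_X))) oo fubini_arg l = 1"
    by simp
  then have "(1 - fubini_arg l) * (fps_lift (1 / (1 - fps_X)) oo fubini_arg l) = 1"
    by (simp add: fps_compose_mult_distrib fps_compose_sub_distrib fubini_arg_nth_0)
  moreover have "1 - fubini_arg l \<noteq> 0"
    using fubini_geom[of l] by auto
  ultimately show ?thesis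
    using fubini_geom[of l] by (metis mult_cancel_left)
qed

lemma harmonic_fubini_eq:
  "harmonic_fubini l k = fubini_poly l (- (deg_log_minus l / (1 - fps_X))) k"
proof -
  have u: "fps_nth (fubini_arg l) 0 = 0"
    by (rule fubini_arg_nth_0)
  have "- fps_X oo fubini_arg l = - fubini_arg l"
    using u by (simp add: fps_compose_uminus)
  moreover have "fps_lift (- fps_X) = - fps_X"
    using fps_lift_diff[of 0 fps_X] fps_lift_diff[of 0 0] by (simp add: fps_lift_X)
  ultimately have log: "fps_lift (deg_log l) oo (- fubini_arg l) = fps_lift (deg_log_minus l) oo fubini_arg l"
    using fps_compose_assoc[OF u, of "- fps_X" "fps_lift (deg_log l)"]
    by (simp add: deg_log_minus_def fps_lift_compose)
  have "fps_lift (deg_log_minus l) * fps_lift (1 / (1 - fps_X)) = fps_lift (deg_log_minus l / (1 - fps_X))"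
    by (simp flip: fps_lift_mult add: fps_divide_unit)
  then have "(fps_lift (deg_log l) oo (- fubini_arg l)) * fubini_geom l
      = fps_lift (deg_log_minus l / (1 - fps_X)) oo fubini_arg l"
    unfolding log fubini_geom_eq by (simp flip: fps_compose_mult_distrib[OF u])
  moreover have "fps_lift (- f) = - fps_lift f" for f
    by (rule fps_ext) (simp add: fps_lift_nth)
  ultimately show ?thesis
    by (simp add: harmonic_fubini_def fubini_poly_def fps_compose_uminus)
qed

lemma deg_fubini_eq: "deg_fubini l a k = fubini_poly l (one_minus_powr (- a)) k"
proof -
  have u: "fps_nth (fubini_arg l) 0 = 0"
    by (rule fubini_arg_nth_0)
  have g: "fubini_geom l - 1 = fps_lift (1 / (1 - fps_X) - 1) oo fubini_arg l"
    by (simp add: fubini_geom_eq fps_lift_diff fps_lift_1 fps_compose_sub_distrib)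
  have 0: "fps_nth (fps_lift (1 / (1 - fps_X) - 1)) 0 = 0"
    by (simp add: fps_lift_nth fps_divide_unit)
  have "fps_lift (fps_binomial a) oo (fubini_geom l - 1)
      = fps_lift (fps_binomial a oo (1 / (1 - fps_X) - 1)) oo fubini_arg l"
    unfolding g fps_lift_compose by (rule fps_compose_assoc[OF u 0])
  then show ?thesis
    by (simp add: deg_fubini_def fubini_poly_def fps_binomial_compose_geometric)
qed

lemma coeff_fubini_poly:
  "coeff (fubini_poly l g k) j = (if j \<le> k then fps_nth g j * deg_surj l k j else 0)"
proof -
  have "[:0, 1:] ^ i = (monom 1 i :: real poly)" for i
    by (simp add: monom_altdef)
  then have pow: "fps_nth (fubini_arg l ^ i) k = monom (fps_nth ((deg_exp l - 1) ^ i) k) i" for i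
    by (simp add: fubini_arg_def power_mult_distrib fps_lift_nth fps_const_power mult.commute
                  [of "monom 1 i"] smult_monom
             flip: fps_lift_1 fps_lift_diff fps_lift_power)
  then show ?thesis
    by (simp add: fubini_poly_def fps_compose_nth fps_lift_nth pow smult_monom coeff_sum
                  deg_surj_def)
qed

lemma poly_at_fps_fubini_poly:
  "poly_at_fps (fubini_poly l g k) y =
     (\<Sum>j\<le>k. fps_const (fps_nth g j * deg_surj l k j) * y ^ j)"
proof -
  have "degree (map_poly fps_const (fubini_poly l g k)) \<le> k"
    by (rule degree_le) (simp add: coeff_map_poly coeff_fubini_poly)
  then have "poly_at_fps (fubini_poly l g k) y
      = (\<Sum>j\<le>k. coeff (map_poly fps_const (fubini_poly l g k)) j * y ^ j)"
    unfolding poly_at_fps_def poly_altdef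
    by (intro sum.mono_neutral_left) (auto simp: coeff_eq_0)
  then show ?thesis
    by (simp add: coeff_map_poly coeff_fubini_poly)
qed

lemma poly_at_fps_fubini_poly_diff:
  "poly_at_fps (fubini_poly l (f - g) k) y =
     poly_at_fps (fubini_poly l f k) y - poly_at_fps (fubini_poly l g k) y"
  by (simp add: poly_at_fps_fubini_poly sum_subtractf left_diff_distrib flip: fps_const_sub)

lemma poly_at_fps_fubini_poly_const_mult:
  "poly_at_fps (fubini_poly l (fps_const c * g) k) y =
     fps_const c * poly_at_fps (fubini_poly l g k) y"
  by (simp add: poly_at_fps_fubini_poly sum_distrib_left mult.assoc flip: fps_const_mult)

section \<open>Degenerate falling factorials as weights\<close>

text \<open>This is \<open>k! [t\<^sup>k]\<close> of the power \<open>a\<close> of the factorisation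
  \<open>1 - x e = (1 - x)(1 - x/(1 - x) (e - 1))\<close>, where \<open>e = e\<^sub>\<lambda>(t)\<close>.\<close>

theorem deg_falling_weighted_one_minus_powr:
  assumes "l \<noteq> 0"
  shows "Abs_fps (\<lambda>n. fps_nth (one_minus_powr a) n * deg_falling l (real n) k) =
    one_minus_powr a * poly_at_fps (fubini_poly l (one_minus_powr a) k) (fps_X / (1 - fps_X))"
proof -
  have "Abs_fps (\<lambda>n. fps_nth (one_minus_powr a) n * deg_falling l (real n) k)
      = (\<Sum>j\<le>k. fps_const (deg_surj l k j) *
           Abs_fps (\<lambda>n. fps_nth (one_minus_powr a) n * real (n choose j)))"
    using assms
    by (intro fps_ext)
       (simp add: deg_falling_eq_sum_choose fps_sum_nth sum_distrib_left mult_ac)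
  then show ?thesis
    by (simp add: choose_weighted_one_minus_powr poly_at_fps_fubini_poly sum_distrib_left mult_ac
             flip: fps_const_mult)
qed

section \<open>Degenerate harmonic numbers\<close>

lemma deg_log_minus_divide:
  "deg_log_minus l / (1 - fps_X) =
     fps_const (1 / l) * (one_minus_powr (l - 1) - one_minus_powr (- 1))"
proof -
  have log: "deg_log_minus l = fps_const (1 / l) * (one_minus_powr l - 1)"
    by (simp add: deg_log_minus_def deg_log_def one_minus_powr_def fps_compose_mult_distrib
                  fps_compose_sub_distrib)
  have "deg_log_minus l * one_minus_powr (- 1)
      = fps_const (1 / l) * (one_minus_powr l * one_minus_powr (- 1) - one_minus_powr (- 1))"
    by (simp add: log algebra_simps)
  then show ?thesis
    using one_minus_powr_add[of l "- 1"] by (simp add: divide_one_minus_fps_X)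
qed

theorem theorem9:
  fixes l :: real and k :: nat
  assumes "l \<noteq> 0" and "k \<ge> 1"
  shows "Abs_fps (\<lambda>n. if n \<ge> 1 then deg_harmonic l n * deg_falling l (real n) k else 0) =
         1 / (1 - fps_X) * poly_at_fps (harmonic_fubini l k) (fps_X / (1 - fps_X))
         - deg_log_minus l / (1 - fps_X)
           * poly_at_fps (deg_fubini l (1 - l) k) (fps_X / (1 - fps_X))"
proof -
  define P where "P a = poly_at_fps (fubini_poly l (one_minus_powr a) k) (fps_X / (1 - fps_X))" for a
  define A B where "A = one_minus_powr (l - 1)" and "B = one_minus_powr (- 1)"
  define c where "c = - (1 / l)"
  have gen: "- (deg_log_minus l / (1 - fps_X)) = fps_const c * (A - B)"
    by (simp add: deg_log_minus_divide A_def B_def c_def flip: fps_const_neg)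
  have HF: "poly_at_fps (harmonic_fubini l k) (fps_X / (1 - fps_X)) = fps_const c * (P (l - 1) - P (- 1))"
    by (simp only: harmonic_fubini_eq gen poly_at_fps_fubini_poly_const_mult
                   poly_at_fps_fubini_poly_diff P_def A_def B_def)
  have F: "poly_at_fps (deg_fubini l (1 - l) k) (fps_X / (1 - fps_X)) = P (l - 1)"
    by (simp add: deg_fubini_eq P_def)
  have "Abs_fps (\<lambda>n. if n \<ge> 1 then deg_harmonic l n * deg_falling l (real n) k else 0)
      = Abs_fps (\<lambda>n. deg_harmonic l n * deg_falling l (real n) k)"
    by (rule fps_ext) (auto simp: deg_harmonic_0 not_le)
  also have "\<dots> = fps_const c * (Abs_fps (\<lambda>n. fps_nth A n * deg_falling l (real n) k)
                             - Abs_fps (\<lambda>n. fps_nth B n * deg_falling l (real n) k))"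
    by (rule fps_ext) (simp add: deg_harmonic_def gen del: fps_neg_nth add: algebra_simps)
  also have "\<dots> = fps_const c * (A * P (l - 1) - B * P (- 1))"
    using assms(1) by (simp add: deg_falling_weighted_one_minus_powr A_def B_def P_def)
  also have "\<dots> = B * (fps_const c * (P (l - 1) - P (- 1))) + fps_const c * (A - B) * P (l - 1)"
    by (simp add: algebra_simps)
  also have "\<dots> = 1 / (1 - fps_X) * poly_at_fps (harmonic_fubini l k) (fps_X / (1 - fps_X))
         - deg_log_minus l / (1 - fps_X)
           * poly_at_fps (deg_fubini l (1 - l) k) (fps_X / (1 - fps_X))"
    unfolding HF F gen[symmetric] by (simp add: B_def divide_one_minus_fps_X)
  finally show ?thesis .
qed

end
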